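(* For all integers $k \geq 0$ and $n \geq 0$, the number of vertices labeled by $n$ in the $k$-extended action graph $A^k_n$ is equal to $C^k_n$, the $n$th term of the $k$th self-convolution of the Catalan sequence.
   Context: Catalan numbers: $C_0 = 1$ and $C_{n+1} = \sum_{i=0}^n C_i C_{n-i}$ for $n \geq 0$. Self-convolutions: the convolution of two sequences $A = (A_n)_{n\ge 0}$ and $B = (B_n)_{n \ge 0}$ is $(A \ast B)_n = \sum_{m=0}^n A_m B_{n-m}$. For $k \geq 0$, $C^k$ denotes the sequence $C \ast \cdots \ast C$ with $k+1$ factors, where $C = (C_n)_{n\ge0}$; in particular $C^0 = C$ and $C^1 = C \ast C$. Its $n$th term is denoted $C^k_n$. Directed graphs: a directed graph is a pair $(V,E)$ where $V$ is a set of vertices and $E$ is a set of ordered pairs of vertices, called edges; the edge $e=(v,w)$ has source $s(e) = v$ and target $t(e) = w$. It is assumed that $(v,v) \in E$ for every $v \in V$; these edges are called trivial edges, and there are no other loops and no multiple edges. A (directed) path is a sequence of edges $e_1, \ldots, e_m$ ($m \geq 1$) with $t(e_i) = s(e_{i+1})$ for $1 \leq i < m$, where if $m > 1$ all the edges are required to be nontrivial. Its initial vertex is $s(e_1)$ and its terminal vertex is $t(e_m)$. In particular, each vertex $v$ gives exactly one trivial path from $v$ to $v$. A labeling of a directed graph by a set $S$ is a function $V \to S$. $k$-extended action graphs: for $k \geq 0$, the graphs $A^k_n$, $n \geq 0$, are directed graphs labeled by $\mathbb{N} \cup \{-k, -k+1, \ldots, -1\}$ (with $0\in\mathbb{N}$;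 for $k=0$ the label set is $\mathbb{N}$), defined inductively. The graph $A^k_0$ is the linear graph $\bullet_{-k} \to \bullet_{-k+1} \to \cdots \to \bullet_{-1} \to \bullet_0$ with $k+1$ vertices labeled $-k, \ldots, 0$ (for $k=0$ it is a single vertex labeled $0$ with no nontrivial edges). Given $A^k_n$, the graph $A^k_{n+1}$ is obtained by freely adjoining new edges as follows: for each vertex $v$ of $A^k_n$ labeled by $n$ and each path in $A^k_n$ with terminal vertex $v$ (including the trivial path at $v$), adjoin one new edge whose source is the initial vertex of that path and whose target is a new vertex labeled by $n+1$ (distinct paths give distinct new vertices). *)

theory Defs
  imports Complex_Main "Graph_Theory.Pair_Digraph"
begin

section \<open>Catalan numbers and self-convolutions\<close>

fun catalan :: "nat \<Rightarrow> nat" where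
  "catalan 0 = 1"
| "catalan (Suc n) = (\<Sum>i\<le>n. catalan i * catalan (n - i))"

definition convolution :: "(nat \<Rightarrow> nat) \<Rightarrow> (nat \<Rightarrow> nat) \<Rightarrow> nat \<Rightarrow> nat" where
  "convolution A B n = (\<Sum>m\<le>n. A m * B (n - m))"

text \<open>The exponent is shifted: \<open>self_convolution A k\<close> has \<open>k + 1\<close> factors.\<close>

primrec self_convolution :: "(nat \<Rightarrow> nat) \<Rightarrow> nat \<Rightarrow> nat \<Rightarrow> nat" where
  "self_convolution A 0 = A"
| "self_convolution A (Suc k) = convolution A (self_convolution A k)"


section \<open>Labeled directed graphs and paths\<close>

text \<open>Only the values of \<open>label\<close> on the vertices of \<open>graph_of\<close> are meaningful.\<close>

record 'v labeled_digraph =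
  graph_of :: "'v pair_pre_digraph"
  label :: "'v \<Rightarrow> int"

text \<open>
  Graphs here carry a trivial edge \<open>(v, v)\<close> at each vertex. A path has at least one edge,
  and trivial edges occur only in paths of length one; the empty walks allowed
  by \<open>awalk\<close> are excluded, so that the trivial path at \<open>v\<close> is \<open>[(v, v)]\<close> and nothing else.
\<close>

definition dpath :: "'v pair_pre_digraph \<Rightarrow> 'v \<Rightarrow> ('v \<times> 'v) list \<Rightarrow> 'v \<Rightarrow> bool" where
  "dpath G u p v \<longleftrightarrow>
     p \<noteq> [] \<and> pre_digraph.awalk (with_proj G) u p v \<and>
     (length p > 1 \<longrightarrow> (\<forall>e\<in>set p. fst e \<noteq> snd e))"


section \<open>Extended action graphs\<close>

text \<open>
  \<open>Base i\<close> is the vertex labeled \<open>i\<close> of the initial linear graph; \<open>New n p\<close> is the vertex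
  that is adjoined for the path \<open>p\<close> at stage \<open>n\<close>. The lemma \<open>new_vertex_fresh\<close> below
  shows that the adjoined vertices are indeed new, i.e. that the adjunction is free.
\<close>

datatype avertex = Base int | New nat "(avertex \<times> avertex) list"

definition linear_graph :: "nat \<Rightarrow> avertex labeled_digraph" where
  "linear_graph k =
     \<lparr> graph_of =
         \<lparr> pverts = Base ` {- int k..0},
           parcs = (\<lambda>i. (Base i, Base (i + 1))) ` {- int k..<0}
                 \<union> (\<lambda>i. (Base i, Base i)) ` {- int k..0} \<rparr>,
       label = (\<lambda>v. case v of Base i \<Rightarrow> i | New _ _ \<Rightarrow> undefined) \<rparr>"

definition paths_to_label :: "'v labeled_digraph \<Rightarrow> int \<Rightarrow> ('v \<times> 'v) list set" where
  "paths_to_label G l =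
     {p. \<exists>u v. dpath (graph_of G) u p v \<and> v \<in> pverts (graph_of G) \<and> label G v = l}"

text \<open>The initial vertex of a path \<open>p\<close> is \<open>fst (hd p)\<close>.\<close>

definition adjoin :: "nat \<Rightarrow> avertex labeled_digraph \<Rightarrow> avertex labeled_digraph" where
  "adjoin n G =
     (let P = paths_to_label G (int n); N = New (Suc n) ` P in
      \<lparr> graph_of =
          \<lparr> pverts = pverts (graph_of G) \<union> N,
            parcs = parcs (graph_of G)
                  \<union> (\<lambda>p. (fst (hd p), New (Suc n) p)) ` P
                  \<union> (\<lambda>v. (v, v)) ` N \<rparr>,
        label = (\<lambda>v. if v \<in> N then int (Suc n) else label G v) \<rparr>)"

primrec action_graph :: "nat \<Rightarrow> nat \<Rightarrow> avertex labeled_digraph" where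
  "action_graph k 0 = linear_graph k"
| "action_graph k (Suc n) = adjoin n (action_graph k n)"

lemma new_vertex_stage:
  "New m p \<in> pverts (graph_of (action_graph k n)) \<Longrightarrow> m \<le> n"
  by (induction n) (auto simp: linear_graph_def adjoin_def Let_def)

lemma new_vertex_fresh:
  "New (Suc n) p \<notin> pverts (graph_of (action_graph k n))"
  using new_vertex_stage by fastforce

end

theory Submission
  imports Defs "HOL-Computational_Algebra.Formal_Power_Series"
begin

text \<open>
  Every action graph is a tree rooted at the vertex labeled \<open>- k\<close>, so the paths ending at a
  vertex \<open>v\<close> correspond to the vertices between the root and \<open>v\<close>; their number is the height
  \<open>h v\<close>, and their initial vertices have heights \<open>1, \<dots>, h v\<close>. Hence a vertex of height \<open>h\<close>
  with label \<open>n\<close> gives rise to one vertex of each of the heights \<open>2, \<dots>, h + 1\<close> with label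
  \<open>n + 1\<close>. The generating function identity \<open>C = 1 + x C\<^sup>2\<close> shows that the numbers
  \<open>C\<^sup>k\<^sub>n\<close> obey the matching recursion \<open>C\<^sup>k\<^sub>n\<^sub>+\<^sub>1 = C\<^sup>1\<^sub>n + \<dots> + C\<^sup>k\<^sup>+\<^sup>1\<^sub>n\<close>.
\<close>

section \<open>Powers of the Catalan generating function\<close>

lemma self_convolution_eq_fps_power:
  "self_convolution A k n = fps_nth (Abs_fps A ^ Suc k) n"
proof (induction k arbitrary: n)
  case (Suc k)
  have "self_convolution A (Suc k) n = fps_nth (Abs_fps A * Abs_fps A ^ Suc k) n"
    unfolding fps_mult_nth by (simp add: convolution_def Suc atLeast0AtMost)
  then show ?case by simp
qed simp

lemma self_convolution_zero: "self_convolution A k 0 = A 0 ^ Suc k"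
  by (induction k) (simp_all add: convolution_def)

lemma catalan_fps_eq:
  "Abs_fps catalan = 1 + fps_X * (Abs_fps catalan * Abs_fps catalan)"
proof (rule fps_ext)
  fix n
  show "fps_nth (Abs_fps catalan) n =
    fps_nth (1 + fps_X * (Abs_fps catalan * Abs_fps catalan)) n"
    by (cases n)
      (simp_all add: fps_X_mult_nth fps_mult_nth[of "Abs_fps catalan"] atLeast0AtMost)
qed

text \<open>Multiplying \<open>C = 1 + x * C^2\<close> by the ordinary power \<open>C^(k+1)\<close>
  gives \<open>C^(k+2) = C^(k+1) + x * C^(k+3)\<close>. Its coefficient at \<open>x^(m+1)\<close>
  adds the last summand.\<close>

lemma self_convolution_catalan_Suc:
  "self_convolution catalan k (Suc m) = (\<Sum>j=1..Suc k. self_convolution catalan j m)"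
proof (induction k)
  case 0
  show ?case by (simp add: convolution_def)
next
  case (Suc k)
  let ?C = "Abs_fps catalan"
  have "?C ^ Suc (Suc k) = ?C * ?C ^ Suc k" by simp
  also have "\<dots> = (1 + fps_X * (?C * ?C)) * ?C ^ Suc k" using catalan_fps_eq by simp
  also have "\<dots> = ?C ^ Suc k + fps_X * ?C ^ Suc (Suc (Suc k))"
    by (simp add: algebra_simps)
  finally have "self_convolution catalan (Suc k) (Suc m) =
      self_convolution catalan k (Suc m) + self_convolution catalan (Suc (Suc k)) m"
    unfolding self_convolution_eq_fps_power
    by (metis fps_add_nth fps_X_mult_nth diff_Suc_1 nat.distinct(1))
  then show ?case using Suc by simp
qed

section \<open>Paths and heights\<close>

lemma cas_with_proj_snoc:
  "pre_digraph.cas (with_proj G) u (p @ [e]) v \<longleftrightarrow>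
     pre_digraph.cas (with_proj G) u p (fst e) \<and> snd e = v"
  by (induction p arbitrary: u) (auto simp: pre_digraph.cas.simps)

text \<open>Leaves are attached at the targets of arcs, so paths are taken apart at their last edge.
  Only when nothing precedes that edge may it be trivial.\<close>

lemma dpath_snoc:
  "dpath G u (p @ [e]) v \<longleftrightarrow>
     snd e = v \<and> e \<in> parcs G \<and>
     (if p = [] then u = fst e \<and> u \<in> pverts G
      else dpath G u p (fst e) \<and> (\<forall>a\<in>set (p @ [e]). fst a \<noteq> snd a))"
  by (cases p)
    (auto simp: dpath_def pre_digraph.awalk_def cas_with_proj_snoc
      pre_digraph.cas.simps simp flip: append_Cons)

lemma dpath_Nil: "\<not> dpath G u [] v"
  by (simp add: dpath_def)

definition paths_to :: "'v pair_pre_digraph \<Rightarrow> 'v \<Rightarrow> ('v \<times> 'v) list set" where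
  "paths_to G v = {p. \<exists>u. dpath G u p v}"

text \<open>The trivial path counts, so the root of a tree has height 1 rather than 0.\<close>

definition height :: "'v pair_pre_digraph \<Rightarrow> 'v \<Rightarrow> nat" where
  "height G v = card (paths_to G v)"

lemma dpath_fst_hd: "dpath G u p v \<Longrightarrow> fst (hd p) = u"
  by (cases p) (auto simp: dpath_def pre_digraph.awalk_def pre_digraph.cas.simps)

lemma dpath_source_in: "dpath G u p v \<Longrightarrow> u \<in> pverts G"
  by (simp add: dpath_def pre_digraph.awalk_def)

lemma paths_to_last: "p \<in> paths_to G v \<Longrightarrow> snd (last p) = v"
  by (cases p rule: rev_cases) (auto simp: paths_to_def dpath_snoc dpath_Nil)

lemma paths_to_source_in: "p \<in> paths_to G v \<Longrightarrow> fst (hd p) \<in> pverts G"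
  using dpath_fst_hd dpath_source_in by (fastforce simp: paths_to_def)

text \<open>
  In a rooted tree, the paths to \<open>v\<close> start at the vertices between the root and \<open>v\<close>, exactly
  one of each height.
\<close>

definition graded_by_height :: "'v pair_pre_digraph \<Rightarrow> bool" where
  "graded_by_height G \<longleftrightarrow>
     finite (pverts G) \<and> parcs G \<subseteq> pverts G \<times> pverts G \<and>
     (\<forall>v\<in>pverts G. (v, v) \<in> parcs G) \<and>
     (\<forall>v\<in>pverts G. bij_betw (\<lambda>p. height G (fst (hd p))) (paths_to G v) {1..height G v})"

lemma graded_by_height_finite_paths_to:
  "graded_by_height G \<Longrightarrow> v \<in> pverts G \<Longrightarrow> finite (paths_to G v)"
  using bij_betw_finite unfolding graded_by_height_def by blast

lemma graded_by_height_single: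
  "graded_by_height \<lparr>pverts = {r}, parcs = {(r, r)}\<rparr>"
  "height \<lparr>pverts = {r}, parcs = {(r, r)}\<rparr> r = 1"
proof -
  let ?G = "\<lparr>pverts = {r}, parcs = {(r, r)}\<rparr>"
  have "p \<in> paths_to ?G r \<longleftrightarrow> p = [(r, r)]" for p
    by (cases p rule: rev_cases) (auto simp: paths_to_def dpath_snoc dpath_Nil)
  then have *: "paths_to ?G r = {[(r, r)]}" by blast
  then show "height ?G r = 1" by (simp add: height_def)
  with * show "graded_by_height ?G"
    by (simp add: graded_by_height_def bij_betw_def)
qed

section \<open>Adjoining leaves\<close>

text \<open>Common form of lengthening a linear graph and of passing to the next action graph:
  \<open>f\<close> sends each new leaf to its parent.\<close>

definition adjoin_leaves ::
    "'v pair_pre_digraph \<Rightarrow> 'v set \<Rightarrow> ('v \<Rightarrow> 'v) \<Rightarrow> 'v pair_pre_digraph" where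
  "adjoin_leaves G N f =
     \<lparr>pverts = pverts G \<union> N,
      parcs = parcs G \<union> (\<lambda>x. (f x, x)) ` N \<union> (\<lambda>x. (x, x)) ` N\<rparr>"

context
  fixes G :: "'v pair_pre_digraph" and N :: "'v set" and f :: "'v \<Rightarrow> 'v"
  assumes graded: "graded_by_height G"
    and fresh: "N \<inter> pverts G = {}"
    and parent: "f ` N \<subseteq> pverts G"
begin

lemma arc_in_verts: "(a, b) \<in> parcs G \<Longrightarrow> a \<in> pverts G \<and> b \<in> pverts G"
  using graded by (auto simp: graded_by_height_def)

lemma parent_neq: "x \<in> N \<Longrightarrow> f x \<noteq> x"
  using fresh parent by (metis disjoint_iff image_subset_iff)

text \<open>Every new arc ends in \<open>N\<close>, which is disjoint from \<open>G\<close>;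
  followed backwards from an old vertex, a path never leaves \<open>G\<close>.\<close>

lemma dpath_adjoin_leaves_old:
  "v \<in> pverts G \<Longrightarrow> dpath (adjoin_leaves G N f) u p v \<longleftrightarrow> dpath G u p v"
proof (induction p arbitrary: v rule: rev_induct)
  case (snoc e p)
  obtain a b where e: "e = (a, b)" by force
  show ?case
  proof (cases "b = v \<and> e \<in> parcs G")
    case True
    then have "a \<in> pverts G" using arc_in_verts e by blast
    with True snoc.IH[of a] show ?thesis
      unfolding dpath_snoc by (auto simp: e adjoin_leaves_def)
  next
    case False
    then show ?thesis
      using snoc.prems fresh unfolding dpath_snoc by (auto simp: e adjoin_leaves_def)
  qed
qed (simp add: dpath_Nil)

lemma paths_to_adjoin_leaves_old:
  "v \<in> pverts G \<Longrightarrow> paths_to (adjoin_leaves G N f) v = paths_to G v"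
  by (simp add: paths_to_def dpath_adjoin_leaves_old)

lemma height_adjoin_leaves_old:
  "v \<in> pverts G \<Longrightarrow> height (adjoin_leaves G N f) v = height G v"
  by (simp add: height_def paths_to_adjoin_leaves_old)

text \<open>The trivial path at \<open>f x\<close> is not a prefix of a longer path; it has to be dropped.\<close>

definition extend_path :: "'v \<Rightarrow> ('v \<times> 'v) list \<Rightarrow> ('v \<times> 'v) list" where
  "extend_path x p = (if p = [(f x, f x)] then [] else p) @ [(f x, x)]"

text \<open>A trivial edge occurs only in a path of length one, which would then be the excluded
  loop at \<open>v\<close>.\<close>

lemma dpath_nontrivial:
  assumes "dpath G u p v" "p \<noteq> [(v, v)]" "a \<in> set p"
  shows "fst a \<noteq> snd a"
proof (cases "length p > 1")
  case True
  then show ?thesis using assms by (auto simp: dpath_def)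
next
  case False
  then obtain e where "p = [e]" using assms(3) by (cases p) auto
  then show ?thesis using assms dpath_snoc[of G u "[]" e v] by (cases e) auto
qed

text \<open>The only arcs into \<open>x\<close> are its loop and the arc from \<open>f x\<close>, so
  a path to \<open>x\<close> is the loop or arises from a path to \<open>f x\<close>.\<close>

lemma paths_to_adjoin_leaves_new:
  assumes x: "x \<in> N"
  shows "paths_to (adjoin_leaves G N f) x =
    insert [(x, x)] (extend_path x ` paths_to G (f x))"
proof -
  let ?H = "adjoin_leaves G N f"
  have fx: "f x \<in> pverts G" "x \<notin> pverts G" "f x \<noteq> x"
    using x parent fresh parent_neq by auto
  have loop: "[(f x, f x)] \<in> paths_to G (f x)"
    using fx graded dpath_snoc[of G "f x" "[]" "(f x, f x)" "f x"]
    by (auto simp: paths_to_def graded_by_height_def)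
  have arcs: "(a, x) \<in> parcs ?H \<longleftrightarrow> a = x \<or> a = f x" for a
    using x fx arc_in_verts by (auto simp: adjoin_leaves_def)
  have verts: "x \<in> pverts ?H" "f x \<in> pverts ?H"
    using x fx by (auto simp: adjoin_leaves_def)
  show ?thesis
  proof (intro equalityI subsetI)
    fix p assume "p \<in> paths_to ?H x"
    then obtain u where p: "dpath ?H u p x" by (auto simp: paths_to_def)
    then obtain q e where qe: "p = q @ [e]" by (cases p rule: rev_cases) (auto simp: dpath_Nil)
    with p obtain a where e: "e = (a, x)" and a: "a = x \<or> a = f x"
      using arcs by (cases e) (auto simp: dpath_snoc)
    show "p \<in> insert [(x, x)] (extend_path x ` paths_to G (f x))"
    proof (cases "q = []")
      case True
      \<comment> \<open>The single arc from \<open>f x\<close> to \<open>x\<close> comes from the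
        trivial path at \<open>f x\<close>.\<close>
      then show ?thesis
        using a loop by (auto simp: qe e extend_path_def image_iff intro!: bexI[OF _ loop])
    next
      case False
      with p have "dpath ?H u q a" "\<forall>b\<in>set (q @ [e]). fst b \<noteq> snd b"
        by (auto simp: qe e dpath_snoc)
      then have "a = f x" "dpath G u q (f x)" "q \<noteq> [(f x, f x)]"
        using a fx dpath_adjoin_leaves_old by (auto simp: e)
      then show ?thesis
        by (auto simp: qe e extend_path_def paths_to_def image_iff)
    qed
  next
    fix p assume "p \<in> insert [(x, x)] (extend_path x ` paths_to G (f x))"
    then consider "p = [(x, x)]" | q u where "dpath G u q (f x)" "p = extend_path x q"
      by (auto simp: paths_to_def)
    then show "p \<in> paths_to ?H x"
    proof cases
      case 1
      then show ?thesis
        using verts arcs dpath_snoc[of ?H x "[]" "(x, x)" x] by (auto simp: paths_to_def)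
    next
      case (2 q u)
      show ?thesis
      proof (cases "q = [(f x, f x)]")
        case True
        then show ?thesis
          using 2 verts arcs dpath_snoc[of ?H "f x" "[]" "(f x, x)" x]
          by (auto simp: paths_to_def extend_path_def)
      next
        case False
        have "dpath ?H u (q @ [(f x, x)]) x"
          using 2 fx arcs dpath_nontrivial[OF 2(1) False] dpath_adjoin_leaves_old[of "f x"]
          by (auto simp: dpath_snoc dpath_Nil)
        then show ?thesis using False 2 by (auto simp: paths_to_def extend_path_def)
      qed
    qed
  qed
qed

text \<open>This covers the dropped trivial path too, because the arc to \<open>x\<close> also
  starts at \<open>f x\<close>.\<close>

lemma extend_path_source:
  "p \<in> paths_to G v \<Longrightarrow> fst (hd (extend_path x p)) = fst (hd p)"
  by (cases p) (auto simp: extend_path_def paths_to_def dpath_Nil)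

text \<open>The dropped trivial path leaves an empty prefix, which no other path can leave, as paths
  are nonempty.\<close>

lemma inj_on_extend_path: "inj_on (extend_path x) (paths_to G v)"
proof (rule inj_onI)
  fix p q assume "p \<in> paths_to G v" "q \<in> paths_to G v" "extend_path x p = extend_path x q"
  moreover from this have "p \<noteq> []" "q \<noteq> []" by (auto simp: paths_to_def dpath_Nil)
  ultimately show "p = q" unfolding extend_path_def by (simp split: if_splits)
qed

lemma trivial_notin_extend_path:
  assumes "x \<in> N"
  shows "[(x, x)] \<notin> extend_path x ` paths_to G v"
  using parent_neq[OF assms] by (auto simp: extend_path_def split: if_splits)

lemma height_adjoin_leaves_new:
  assumes "x \<in> N"
  shows "height (adjoin_leaves G N f) x = Suc (height G (f x))"
proof -
  have "finite (paths_to G (f x))"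
    using assms parent by (intro graded_by_height_finite_paths_to[OF graded]) auto
  then show ?thesis
    using assms trivial_notin_extend_path
    by (simp add: height_def paths_to_adjoin_leaves_new card_image inj_on_extend_path)
qed

text \<open>Old vertices keep their paths and heights. For a leaf \<open>v\<close>, the extended
  paths keep the initial heights \<open>1\<close> to \<open>height G (f v)\<close>, and the trivial
  path at \<open>v\<close> contributes the one height above these.\<close>

lemma graded_by_height_adjoin_leaves:
  assumes "finite N"
  shows "graded_by_height (adjoin_leaves G N f)"
proof -
  let ?H = "adjoin_leaves G N f"
  let ?g = "\<lambda>p. height ?H (fst (hd p))"
  have same: "?g p = height G (fst (hd p))" if "p \<in> paths_to G v" for p v
    using height_adjoin_leaves_old[OF paths_to_source_in[OF that]] .
  have old: "bij_betw ?g (paths_to G v) {1..height G v}" if "v \<in> pverts G" for v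
  proof -
    have "bij_betw ?g (paths_to G v) {1..height G v} \<longleftrightarrow>
        bij_betw (\<lambda>p. height G (fst (hd p))) (paths_to G v) {1..height G v}"
      by (rule bij_betw_cong) (rule same)
    then show ?thesis using graded that by (simp add: graded_by_height_def)
  qed
  have "bij_betw ?g (paths_to ?H v) {1..height ?H v}" if v: "v \<in> pverts ?H" for v
  proof (cases "v \<in> pverts G")
    case True
    then show ?thesis
      using old by (simp add: paths_to_adjoin_leaves_old height_adjoin_leaves_old)
  next
    case False
    then have N: "v \<in> N" using v by (simp add: adjoin_leaves_def)
    then have fv: "f v \<in> pverts G" using parent by blast
    have "bij_betw (?g \<circ> extend_path v) (paths_to G (f v)) {1..height G (f v)} \<longleftrightarrow>
        bij_betw ?g (paths_to G (f v)) {1..height G (f v)}"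
      by (rule bij_betw_cong) (simp add: extend_path_source)
    then have "bij_betw (?g \<circ> extend_path v) (paths_to G (f v)) {1..height G (f v)}"
      using old[OF fv] by simp
    then have "bij_betw ?g (extend_path v ` paths_to G (f v)) {1..height G (f v)}"
      by (simp add: bij_betw_comp_iff[OF inj_on_imp_bij_betw[OF inj_on_extend_path]])
    then have "bij_betw ?g (extend_path v ` paths_to G (f v) \<union> {[(v, v)]})
        ({1..height G (f v)} \<union> {?g [(v, v)]})"
      by (intro notIn_Un_bij_betw)
        (use N trivial_notin_extend_path in \<open>auto simp: height_adjoin_leaves_new\<close>)
    moreover have "{1..height G (f v)} \<union> {?g [(v, v)]} = {1..height ?H v}"
      using N by (auto simp: height_adjoin_leaves_new)
    ultimately show ?thesis
      using N by (simp add: paths_to_adjoin_leaves_new)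
  qed
  then show ?thesis
    using graded assms parent unfolding graded_by_height_def
    by (auto simp: adjoin_leaves_def)
qed

end

section \<open>Action graphs\<close>

definition segment :: "int \<Rightarrow> int \<Rightarrow> avertex pair_pre_digraph" where
  "segment a b =
     \<lparr>pverts = Base ` {a..b},
      parcs = (\<lambda>i. (Base i, Base (i + 1))) ` {a..<b} \<union> (\<lambda>i. (Base i, Base i)) ` {a..b}\<rparr>"

text \<open>A segment grows by adjoining one leaf at its right end, which raises the height there by
  one.\<close>

lemma graded_by_height_segment:
  "graded_by_height (segment a (a + int m)) \<and>
   height (segment a (a + int m)) (Base (a + int m)) = Suc m"
proof (induction m)
  case 0
  have "segment a (a + int 0) = \<lparr>pverts = {Base a}, parcs = {(Base a, Base a)}\<rparr>"
    by (simp add: segment_def)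
  then show ?case using graded_by_height_single[of "Base a"] by simp
next
  case (Suc m)
  let ?b = "a + int m"
  have "{a..?b + 1} = insert (?b + 1) {a..?b}" "{a..<?b + 1} = insert ?b {a..<?b}" by auto
  then have seg: "segment a (a + int (Suc m)) =
      adjoin_leaves (segment a ?b) {Base (?b + 1)} (\<lambda>_. Base ?b)"
    by (auto simp: segment_def adjoin_leaves_def add.assoc add.commute[of 1])
  have fresh: "{Base (?b + 1)} \<inter> pverts (segment a ?b) = {}"
    and parent: "(\<lambda>_. Base ?b) ` {Base (?b + 1)} \<subseteq> pverts (segment a ?b)"
    by (auto simp: segment_def)
  note adj = conjunct1[OF Suc] fresh parent
  show ?case
    using graded_by_height_adjoin_leaves[OF adj] height_adjoin_leaves_new[OF adj] Suc
    unfolding seg by (simp add: add.assoc add.commute[of 1])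
qed

lemma graph_of_linear_graph: "graph_of (linear_graph k) = segment (- int k) 0"
  by (simp add: linear_graph_def segment_def)

section \<open>The vertices adjoined at each stage\<close>

fun parent_of :: "avertex \<Rightarrow> avertex" where
  "parent_of (New n p) = fst (hd p)"

definition stage_vertices :: "nat \<Rightarrow> 'v labeled_digraph \<Rightarrow> 'v set" where
  "stage_vertices n G = {v \<in> pverts (graph_of G). label G v = int n}"

lemma paths_to_label_eq:
  "paths_to_label G (int n) = (\<Union>v\<in>stage_vertices n G. paths_to (graph_of G) v)"
  by (auto simp: paths_to_label_def stage_vertices_def paths_to_def)

lemma graph_of_adjoin:
  "graph_of (adjoin n G) =
     adjoin_leaves (graph_of G) (New (Suc n) ` paths_to_label G (int n)) parent_of"
  by (simp add: adjoin_def adjoin_leaves_def Let_def image_image)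

lemma label_action_graph_le:
  "v \<in> pverts (graph_of (action_graph k n)) \<Longrightarrow> label (action_graph k n) v \<le> int n"
  by (induction n) (force simp: linear_graph_def adjoin_def Let_def)+

text \<open>Labels in the preceding graph are at most \<open>n\<close>, so no older vertex carries
  the label \<open>n + 1\<close>.\<close>

lemma stage_vertices_Suc:
  "stage_vertices (Suc n) (action_graph k (Suc n)) =
     New (Suc n) ` paths_to_label (action_graph k n) (int n)"
proof -
  have "label (action_graph k n) v \<noteq> int (Suc n)"
    if "v \<in> pverts (graph_of (action_graph k n))" for v
    using label_action_graph_le[OF that] by simp
  then show ?thesis
    by (auto simp: stage_vertices_def adjoin_def Let_def simp del: of_nat_Suc)
qed

lemma parent_of_new_in:
  "parent_of ` New (Suc n) ` paths_to_label G (int n) \<subseteq> pverts (graph_of G)"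
  by (auto simp: paths_to_label_eq dest: paths_to_source_in)

lemma new_disjoint:
  "New (Suc n) ` P \<inter> pverts (graph_of (action_graph k n)) = {}"
  using new_vertex_fresh by blast

lemma finite_paths_to_label:
  "graded_by_height (graph_of G) \<Longrightarrow> finite (paths_to_label G (int n))"
  unfolding paths_to_label_eq
  by (intro finite_UN_I graded_by_height_finite_paths_to)
    (auto simp: stage_vertices_def graded_by_height_def)

lemma graded_by_height_action_graph: "graded_by_height (graph_of (action_graph k n))"
proof (induction n)
  case 0
  show ?case
    using graded_by_height_segment[of "- int k" k] by (simp add: graph_of_linear_graph)
next
  case (Suc n)
  then show ?case
    using graded_by_height_adjoin_leaves[OF Suc new_disjoint parent_of_new_in]
    by (simp add: graph_of_adjoin finite_paths_to_label)
qed

section \<open>Distribution of heights from one stage to the next\<close>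

text \<open>The arbitrary weight \<open>F\<close> makes this a statement about the multiset of
  heights: a vertex of height \<open>h\<close> is replaced by vertices of heights \<open>2\<close>
  to \<open>h + 1\<close>.\<close>

lemma sum_stage_vertices_Suc:
  fixes F :: "nat \<Rightarrow> nat" and k n :: nat
  defines "A \<equiv> action_graph k"
  shows "(\<Sum>x\<in>stage_vertices (Suc n) (A (Suc n)). F (height (graph_of (A (Suc n))) x)) =
    (\<Sum>v\<in>stage_vertices n (A n). \<Sum>j=1..height (graph_of (A n)) v. F (Suc j))"
proof -
  let ?G = "graph_of (A n)" and ?P = "paths_to_label (A n) (int n)"
  have graded: "graded_by_height ?G" by (simp add: A_def graded_by_height_action_graph)
  have disj: "New (Suc n) ` ?P \<inter> pverts ?G = {}" by (simp add: A_def new_disjoint)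
  have fin: "finite (stage_vertices n (A n))"
    using graded by (simp add: stage_vertices_def graded_by_height_def)
  have verts: "v \<in> pverts ?G" if "v \<in> stage_vertices n (A n)" for v
    using that by (simp add: stage_vertices_def)
  have "(\<Sum>x\<in>stage_vertices (Suc n) (A (Suc n)). F (height (graph_of (A (Suc n))) x)) =
      (\<Sum>x\<in>New (Suc n) ` ?P. F (Suc (height ?G (parent_of x))))"
    unfolding A_def stage_vertices_Suc
    using height_adjoin_leaves_new[OF graded disj parent_of_new_in]
    by (intro sum.cong) (auto simp: A_def graph_of_adjoin)
  also have "\<dots> = (\<Sum>p\<in>?P. F (Suc (height ?G (fst (hd p)))))"
    by (subst sum.reindex) (auto simp: inj_on_def)
  also have "\<dots> = (\<Sum>v\<in>stage_vertices n (A n).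
      \<Sum>p\<in>paths_to ?G v. F (Suc (height ?G (fst (hd p)))))"
    \<comment> \<open>The path sets of distinct vertices are disjoint, since the last edge of a path
      determines its terminal vertex.\<close>
    unfolding paths_to_label_eq
    by (rule sum.UNION_disjoint)
      (use fin verts graded_by_height_finite_paths_to[OF graded] in
        \<open>auto dest: paths_to_last\<close>)
  also have "\<dots> = (\<Sum>v\<in>stage_vertices n (A n). \<Sum>j=1..height ?G v. F (Suc j))"
  proof (rule sum.cong)
    fix v assume "v \<in> stage_vertices n (A n)"
    then have "bij_betw (\<lambda>p. height ?G (fst (hd p))) (paths_to ?G v) {1..height ?G v}"
      using graded verts by (auto simp: graded_by_height_def)
    then show "(\<Sum>p\<in>paths_to ?G v. F (Suc (height ?G (fst (hd p))))) =
        (\<Sum>j=1..height ?G v. F (Suc j))"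
      by (rule sum.reindex_bij_betw)
  qed simp
  finally show ?thesis .
qed

text \<open>The trivial path at \<open>v\<close> is always present; hence the subtraction in
  \<open>height G v - 1\<close> is never truncated.\<close>

lemma height_pos:
  assumes "graded_by_height G" "v \<in> pverts G"
  shows "height G v > 0"
proof -
  have "[(v, v)] \<in> paths_to G v"
    using assms dpath_snoc[of G v "[]" "(v, v)" v]
    by (auto simp: paths_to_def graded_by_height_def)
  then show ?thesis
    using assms graded_by_height_finite_paths_to by (auto simp: height_def card_gt_0_iff)
qed

text \<open>The free index \<open>m\<close> makes the induction work: by the Catalan recursion the
  sum for \<open>n + 1\<close> and \<open>m\<close> equals the sum for \<open>n\<close> and
  \<open>m + 1\<close>. At stage 0 only \<open>Base 0\<close>, of height \<open>k + 1\<close>,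
  remains.\<close>

lemma sum_stage_vertices_self_convolution:
  "(\<Sum>v\<in>stage_vertices n (action_graph k n).
      self_convolution catalan (height (graph_of (action_graph k n)) v - 1) m) =
   self_convolution catalan k (n + m)"
proof (induction n arbitrary: m)
  case 0
  have "stage_vertices 0 (action_graph k 0) = {Base 0}"
    by (auto simp: stage_vertices_def linear_graph_def)
  moreover have "height (graph_of (action_graph k 0)) (Base 0) = Suc k"
    using graded_by_height_segment[of "- int k" k] by (simp add: graph_of_linear_graph)
  ultimately show ?case by simp
next
  case (Suc n)
  let ?h = "height (graph_of (action_graph k n))"
  have "(\<Sum>v\<in>stage_vertices (Suc n) (action_graph k (Suc n)).
      self_convolution catalan (height (graph_of (action_graph k (Suc n))) v - 1) m) =
    (\<Sum>v\<in>stage_vertices n (action_graph k n). \<Sum>j=1..?h v. self_convolution catalan j m)"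
    \<comment> \<open>Here \<open>F h\<close> is \<open>self_convolution catalan (h - 1) m\<close>,
      so a new vertex of height \<open>Suc j\<close> has weight index \<open>j\<close>.\<close>
    by (subst sum_stage_vertices_Suc) simp
  also have "\<dots> = (\<Sum>v\<in>stage_vertices n (action_graph k n).
      self_convolution catalan (?h v - 1) (Suc m))"
  proof (rule sum.cong)
    fix v assume "v \<in> stage_vertices n (action_graph k n)"
    then have "?h v > 0"
      using height_pos[OF graded_by_height_action_graph] by (simp add: stage_vertices_def)
    then show "(\<Sum>j=1..?h v. self_convolution catalan j m) =
        self_convolution catalan (?h v - 1) (Suc m)"
      using self_convolution_catalan_Suc[of "?h v - 1" m] by simp
  qed simp
  finally show ?case using Suc by simp
qed

theorem theorem3p1:
  fixes k n :: nat
  shows "card {v \<in> pverts (graph_of (action_graph k n)). label (action_graph k n) v = int n}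
         = self_convolution catalan k n"
  using sum_stage_vertices_self_convolution[where n = n and k = k and m = 0]
  \<comment> \<open>At \<open>m = 0\<close> every weight is a power of \<open>catalan 0 = 1\<close>,
    so the sum counts the vertices.\<close>
  unfolding self_convolution_zero by (simp add: stage_vertices_def)

end
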